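(* Consider the two-vintage news/noise state space model $$ \begin{bmatrix} y_t^{1}\\ y_t^{2}\end{bmatrix} =\begin{bmatrix}1&1&0&1&0\\1&0&1&0&1\end{bmatrix} \begin{bmatrix}\tilde y_t\\ \nu_t^{1}\\ \nu_t^{2}\\ \zeta_t^{1}\\ \zeta_t^{2}\end{bmatrix}, $$ $$ \begin{bmatrix}\tilde y_t\\ \nu_t^{1}\\ \nu_t^{2}\\ \zeta_t^{1}\\ \zeta_t^{2}\end{bmatrix} =\begin{bmatrix}\rho&0&0&0&0\\0&0&0&0&0\\0&0&0&0&0\\0&0&0&0&0\\0&0&0&0&0\end{bmatrix} \begin{bmatrix}\tilde y_{t-1}\\ \nu_{t-1}^{1}\\ \nu_{t-1}^{2}\\ \zeta_{t-1}^{1}\\ \zeta_{t-1}^{2}\end{bmatrix} +\begin{bmatrix}1&1&1&0&0\\0&-1&-1&0&0\\0&0&-1&0&0\\0&0&0&1&0\\0&0&0&0&1\end{bmatrix} \begin{bmatrix}\eta_{t,\tilde y}\\ \eta_{t,\nu}^{1}\\ \eta_{t,\nu}^{2}\\ \eta_{t,\zeta}^{1}\\ \eta_{t,\zeta}^{2}\end{bmatrix}, $$ where the shock vectors are i.i.d. over $t$ with distribution $N(0,H)$, $H=\mathrm{diag}(\sigma_{\tilde y}^2,\sigma_{\nu1}^2,\sigma_{\nu2}^2,\sigma_{\zeta1}^2,\sigma_{\zeta2}^2)$, and only $z_t=(y_t^1,y_t^2)'$ is observed. Let $\theta=(\rho,\sigma_{\tilde y}^2,\sigma_{\nu1}^2,\sigma_{\nu2}^2,\sigma_{\zeta1}^2,\sigma_{\zeta2}^2)'$.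 Suppose that the following assumptions of Komunjer and Ng (2011) hold for every admissible $\theta$ (with $A,B,C,D,\Sigma,K$ and $\epsilon_t$ as defined in the context): 1. (Assumption 1) the shock vector $\epsilon_t$ is zero-mean white noise with positive definite covariance matrix $\Sigma(\theta)$; 2. (Assumption 2) stability: $|A(\theta)|=|\rho|<1$; 3. (Assumption 4-NS) $D(\theta)\Sigma(\theta)D(\theta)'$ is nonsingular; 4. (Assumption 5-NS) minimality: $[K(\theta)\ \ A(\theta)K(\theta)]$ has full row rank (controllability), and the stacked matrix $\begin{bmatrix}C(\theta)\\ C(\theta)A(\theta)\end{bmatrix}$ has full column rank (observability). Then, given the restrictions implied by the two displayed model equations together with the restriction $$\sigma_{\nu2}^2=0,$$ the model is identified: if two parameter vectors $\theta_0,\theta_1$ satisfying these restrictions are observationally equivalent, then $\theta_0=\theta_1$.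
   Context: **Interpretation.** $\tilde y_t$ is the unobserved true value, $y_t^1,y_t^2$ are two releases (vintages) of its estimate, $\nu_t^i$ are news measurement errors and $\zeta_t^i$ are noise measurement errors. **Reduced shocks.** Put $\omega_{t,\tilde y}=\eta_{t,\tilde y}+\eta_{t,\nu}^1+\eta_{t,\nu}^2$, $\omega_{t,\nu}^1=-\eta_{t,\nu}^1-\eta_{t,\nu}^2$, $\omega_{t,\nu}^2=-\eta_{t,\nu}^2$, $\omega_{t,\zeta}^i=\eta_{t,\zeta}^i$ for $i=1,2$, and $\epsilon_t=(\omega_{t,\tilde y},\omega_{t,\nu}^1,\omega_{t,\nu}^2,\omega_{t,\zeta}^1,\omega_{t,\zeta}^2)'\sim N(0,\Sigma(\theta))$, where $$ \Sigma(\theta)=\begin{bmatrix} \sigma_{\tilde y}^2+\sigma_{\nu1}^2+\sigma_{\nu2}^2 & -\sigma_{\nu1}^2-\sigma_{\nu2}^2 & -\sigma_{\nu2}^2&0&0\\ -\sigma_{\nu1}^2-\sigma_{\nu2}^2&\sigma_{\nu1}^2+\sigma_{\nu2}^2&\sigma_{\nu2}^2&0&0\\ -\sigma_{\nu2}^2&\sigma_{\nu2}^2&\sigma_{\nu2}^2&0&0\\ 0&0&0&\sigma_{\zeta1}^2&0\\ 0&0&0&0&\sigma_{\zeta2}^2\end{bmatrix}. $$ **System matrices.** With $x_t=\tilde y_t$ and $z_t=(y_t^1,y_t^2)'$ the model reads $x_{t+1}=A(\theta)x_t+B(\theta)\epsilon_{t+1}$, $z_{t+1}=C(\theta)x_t+D(\theta)\epsilon_{t+1}$,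 where $A(\theta)=\rho$, $B(\theta)=[1\ 0\ 0\ 0\ 0]$, $C(\theta)=(\rho,\rho)'$ and $$D(\theta)=\begin{bmatrix}1&1&0&1&0\\1&0&1&0&1\end{bmatrix}.$$ **Kalman gain.** Let $\Sigma_{BB}=B\Sigma B'$, $\Sigma_{BD}=B\Sigma D'$, $\Sigma_{DB}=\Sigma_{BD}'$, $\Sigma_{DD}=D\Sigma D'$. Let $p\ge 0$ be the steady-state variance of the filtered state error, i.e. the nonnegative solution of the Riccati equation $$p=p\rho^2+\Sigma_{BB}-(p\rho C'+\Sigma_{BD})(pCC'+\Sigma_{DD})^{-1}(p\rho C+\Sigma_{DB}).$$ The Kalman gain is $K(\theta)=(p\rho C'+\Sigma_{BD})(pCC'+\Sigma_{DD})^{-1}$, a $1\times 2$ matrix. **Observational equivalence.** For $|\rho|<1$, $(z_t)_{t\in\mathbb Z}$ denotes the stationary zero-mean Gaussian process generated by the model. Two parameter vectors $\theta_0,\theta_1$ are observationally equivalent if they give the same autocovariance function $\Gamma(j)=E[z_tz_{t-j}']$ for all integers $j$ (equivalently, the same spectral density of $z_t$). The model is identified if observationally equivalent admissible parameter vectors are equal.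
   Formalization: With σ_ν2²=0 the third row of Σ(θ) is zero, so Assumption 1's positive definiteness cannot hold; besides the literal (empty) claim, identification is stated with Σ(θ) only required to be positive semidefinite, all other assumptions unchanged. *)

theory Defs
  imports "HOL-Probability.Probability"
begin

section \<open>Gaussian vectors and processes\<close>

text \<open>The normal law with mean m and variance v; it is the point mass at m if v = 0.\<close>

definition normal_law :: "real \<Rightarrow> real \<Rightarrow> real measure" where
  "normal_law m v =
     (if v = 0 then return borel m
      else density lborel (\<lambda>x. ennreal (normal_density m (sqrt v) x)))"

text \<open>X has law N(m, S), where S may be singular: every linear functional of X is normal
  with the corresponding mean and variance.\<close>

definition normal_vector ::
    "'w measure \<Rightarrow> ('w \<Rightarrow> real^'n) \<Rightarrow> real^'n \<Rightarrow> real^'n^'n \<Rightarrow> bool" where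
  "normal_vector M X m S \<longleftrightarrow>
     X \<in> borel_measurable M \<and>
     (\<forall>a. distr M borel (\<lambda>w. a \<bullet> X w) = normal_law (a \<bullet> m) (a \<bullet> (S *v a)))"

definition zero_mean_gaussian_process :: "'w measure \<Rightarrow> (int \<Rightarrow> 'w \<Rightarrow> real^'n) \<Rightarrow> bool" where
  "zero_mean_gaussian_process M X \<longleftrightarrow>
     (\<forall>t. X t \<in> borel_measurable M) \<and>
     (\<forall>T a. finite T \<longrightarrow>
        (\<exists>v\<ge>0. distr M borel (\<lambda>w. \<Sum>t\<in>T. a t \<bullet> X t w) = normal_law 0 v))"

definition stationary_process :: "'w measure \<Rightarrow> (int \<Rightarrow> 'w \<Rightarrow> real^'n) \<Rightarrow> bool" where
  "stationary_process M X \<longleftrightarrow>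
     (\<forall>h. distr M (PiM UNIV (\<lambda>_. borel)) (\<lambda>w t. X (t + h) w)
        = distr M (PiM UNIV (\<lambda>_. borel)) (\<lambda>w t. X t w))"

text \<open>The matrix E[X_t X_s'] of second moments.\<close>

definition second_moment ::
    "'w measure \<Rightarrow> (int \<Rightarrow> 'w \<Rightarrow> real^'n) \<Rightarrow> int \<Rightarrow> int \<Rightarrow> real^'n^'n" where
  "second_moment M X t s = (\<chi> i k. LINT w|M. X t w $ i * X s w $ k)"

definition zero_mean_white_noise ::
    "'w measure \<Rightarrow> (int \<Rightarrow> 'w \<Rightarrow> real^'n) \<Rightarrow> real^'n^'n \<Rightarrow> bool" where
  "zero_mean_white_noise M e S \<longleftrightarrow>
     (\<forall>t i. e t \<in> borel_measurable M \<and>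
            integrable M (\<lambda>w. (e t w $ i)\<^sup>2) \<and> (LINT w|M. e t w $ i) = 0) \<and>
     (\<forall>t s. second_moment M e t s = (if t = s then S else 0))"


section \<open>Matrices\<close>

definition positive_definite :: "real^'n^'n \<Rightarrow> bool" where
  "positive_definite S \<longleftrightarrow> transpose S = S \<and> (\<forall>v. v \<noteq> 0 \<longrightarrow> v \<bullet> (S *v v) > 0)"

definition positive_semidefinite :: "real^'n^'n \<Rightarrow> bool" where
  "positive_semidefinite S \<longleftrightarrow> transpose S = S \<and> (\<forall>v. v \<bullet> (S *v v) \<ge> 0)"

text \<open>Block matrices, indexed by sum types: \<open>hcat P Q\<close> puts Q to the right of P and
  \<open>vcat P Q\<close> puts Q below P.\<close>

definition hcat :: "real^'a^'m \<Rightarrow> real^'b^'m \<Rightarrow> real^('a + 'b)^'m" where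
  "hcat P Q = (\<chi> i j. case j of Inl a \<Rightarrow> P $ i $ a | Inr b \<Rightarrow> Q $ i $ b)"

definition vcat :: "real^'n^'a \<Rightarrow> real^'n^'b \<Rightarrow> real^'n^('a + 'b)" where
  "vcat P Q = (\<chi> i. case i of Inl a \<Rightarrow> P $ a | Inr b \<Rightarrow> Q $ b)"

definition full_row_rank :: "real^'n^'m \<Rightarrow> bool" where
  "full_row_rank P \<longleftrightarrow> rank P = CARD('m)"

definition full_column_rank :: "real^'n^'m \<Rightarrow> bool" where
  "full_column_rank P \<longleftrightarrow> rank P = CARD('n)"


section \<open>The two-vintage news/noise model\<close>

text \<open>The fields after \<open>rho\<close> are variances, not standard deviations.\<close>

record param =
  rho :: real
  var_y :: real
  var_nu1 :: real
  var_nu2 :: real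
  var_zeta1 :: real
  var_zeta2 :: real

definition variances_nonneg :: "param \<Rightarrow> bool" where
  "variances_nonneg \<theta> \<longleftrightarrow>
     0 \<le> var_y \<theta> \<and> 0 \<le> var_nu1 \<theta> \<and> 0 \<le> var_nu2 \<theta> \<and> 0 \<le> var_zeta1 \<theta> \<and> 0 \<le> var_zeta2 \<theta>"

definition H_mat :: "param \<Rightarrow> real^5^5" where
  "H_mat \<theta> = vector
     [vector [var_y \<theta>, 0, 0, 0, 0],
      vector [0, var_nu1 \<theta>, 0, 0, 0],
      vector [0, 0, var_nu2 \<theta>, 0, 0],
      vector [0, 0, 0, var_zeta1 \<theta>, 0],
      vector [0, 0, 0, 0, var_zeta2 \<theta>]]"

definition transition_mat :: "param \<Rightarrow> real^5^5" where
  "transition_mat \<theta> = vector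
     [vector [rho \<theta>, 0, 0, 0, 0],
      vector [0, 0, 0, 0, 0],
      vector [0, 0, 0, 0, 0],
      vector [0, 0, 0, 0, 0],
      vector [0, 0, 0, 0, 0]]"

definition R_mat :: "real^5^5" where
  "R_mat = vector
     [vector [1,  1,  1, 0, 0],
      vector [0, -1, -1, 0, 0],
      vector [0,  0, -1, 0, 0],
      vector [0,  0,  0, 1, 0],
      vector [0,  0,  0, 0, 1]]"

definition D_mat :: "real^5^2" where
  "D_mat = vector
     [vector [1, 1, 0, 1, 0],
      vector [1, 0, 1, 0, 1]]"

text \<open>\<eta> is the shock process, s the process of the vectors consisting of the true value, the
  two news errors and the two noise errors, and z the process of the two observed vintages;
  z is the stationary zero-mean Gaussian process generated by \<theta>.\<close>

definition stationary_model ::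
    "param \<Rightarrow> 'w measure \<Rightarrow> (int \<Rightarrow> 'w \<Rightarrow> real^5) \<Rightarrow> (int \<Rightarrow> 'w \<Rightarrow> real^5)
       \<Rightarrow> (int \<Rightarrow> 'w \<Rightarrow> real^2) \<Rightarrow> bool" where
  "stationary_model \<theta> M \<eta> s z \<longleftrightarrow>
     prob_space M \<and>
     prob_space.indep_vars M (\<lambda>_. borel) \<eta> UNIV \<and>
     (\<forall>t. normal_vector M (\<eta> t) 0 (H_mat \<theta>)) \<and>
     (\<forall>t. s t \<in> borel_measurable M) \<and>
     (\<forall>t. AE w in M. s t w = transition_mat \<theta> *v s (t - 1) w + R_mat *v \<eta> t w) \<and>
     (\<forall>t. AE w in M. z t w = D_mat *v s t w) \<and>
     zero_mean_gaussian_process M z \<and>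
     stationary_process M z"

text \<open>The process z is determined in law by \<theta>, so the underlying probability space is immaterial.
  Taking the space of shock paths as the type of outcomes is no restriction, because the model can
  be realised on it, with \<eta> the coordinate process under the product measure.\<close>

definition has_autocovariance :: "param \<Rightarrow> (int \<Rightarrow> real^2^2) \<Rightarrow> bool" where
  "has_autocovariance \<theta> \<Gamma> \<longleftrightarrow>
     (\<exists>(M :: (int \<Rightarrow> real^5) measure) \<eta> s z.
        stationary_model \<theta> M \<eta> s z \<and> (\<forall>j t. \<Gamma> j = second_moment M z t (t - j)))"

definition observationally_equivalent :: "param \<Rightarrow> param \<Rightarrow> bool" where
  "observationally_equivalent \<theta>\<^sub>0 \<theta>\<^sub>1 \<longleftrightarrow>
     (\<exists>\<Gamma>. has_autocovariance \<theta>\<^sub>0 \<Gamma> \<and> has_autocovariance \<theta>\<^sub>1 \<Gamma>)"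

definition identified_on :: "param set \<Rightarrow> bool" where
  "identified_on P \<longleftrightarrow>
     (\<forall>\<theta>\<^sub>0\<in>P. \<forall>\<theta>\<^sub>1\<in>P. observationally_equivalent \<theta>\<^sub>0 \<theta>\<^sub>1 \<longrightarrow> \<theta>\<^sub>0 = \<theta>\<^sub>1)"


section \<open>Reduced state space form and the assumptions of Komunjer and Ng\<close>

definition Sigma_mat :: "param \<Rightarrow> real^5^5" where
  "Sigma_mat \<theta> = vector
     [vector [var_y \<theta> + var_nu1 \<theta> + var_nu2 \<theta>, - var_nu1 \<theta> - var_nu2 \<theta>, - var_nu2 \<theta>, 0, 0],
      vector [- var_nu1 \<theta> - var_nu2 \<theta>, var_nu1 \<theta> + var_nu2 \<theta>, var_nu2 \<theta>, 0, 0],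
      vector [- var_nu2 \<theta>, var_nu2 \<theta>, var_nu2 \<theta>, 0, 0],
      vector [0, 0, 0, var_zeta1 \<theta>, 0],
      vector [0, 0, 0, 0, var_zeta2 \<theta>]]"

definition A_mat :: "param \<Rightarrow> real^1^1" where
  "A_mat \<theta> = mat (rho \<theta>)"

definition B_mat :: "real^5^1" where
  "B_mat = vector [vector [1, 0, 0, 0, 0]]"

definition C_mat :: "param \<Rightarrow> real^1^2" where
  "C_mat \<theta> = vector [vector [rho \<theta>], vector [rho \<theta>]]"

definition Sigma_BB :: "param \<Rightarrow> real^1^1" where
  "Sigma_BB \<theta> = B_mat ** Sigma_mat \<theta> ** transpose B_mat"

definition Sigma_BD :: "param \<Rightarrow> real^2^1" where
  "Sigma_BD \<theta> = B_mat ** Sigma_mat \<theta> ** transpose D_mat"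

definition Sigma_DB :: "param \<Rightarrow> real^1^2" where
  "Sigma_DB \<theta> = transpose (Sigma_BD \<theta>)"

definition Sigma_DD :: "param \<Rightarrow> real^2^2" where
  "Sigma_DD \<theta> = D_mat ** Sigma_mat \<theta> ** transpose D_mat"

definition gain :: "param \<Rightarrow> real \<Rightarrow> real^2^1" where
  "gain \<theta> p =
     ((p * rho \<theta>) *\<^sub>R transpose (C_mat \<theta>) + Sigma_BD \<theta>) **
     matrix_inv (p *\<^sub>R (C_mat \<theta> ** transpose (C_mat \<theta>)) + Sigma_DD \<theta>)"

definition riccati :: "param \<Rightarrow> real \<Rightarrow> bool" where
  "riccati \<theta> p \<longleftrightarrow>
     (mat p :: real^1^1) = mat (p * (rho \<theta>)\<^sup>2) + Sigma_BB \<theta>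
        - gain \<theta> p ** ((p * rho \<theta>) *\<^sub>R C_mat \<theta> + Sigma_DB \<theta>)"

definition steady_state_variance :: "param \<Rightarrow> real" where
  "steady_state_variance \<theta> = (THE p. 0 \<le> p \<and> riccati \<theta> p)"

definition K_mat :: "param \<Rightarrow> real^2^1" where
  "K_mat \<theta> = gain \<theta> (steady_state_variance \<theta>)"

text \<open>The white noise part of Assumption 1, for the reduced shocks
  \<open>\<epsilon>\<^sub>t = R_mat *v \<eta>\<^sub>t\<close>. Definiteness of \<open>Sigma_mat \<theta>\<close> is kept separate.\<close>

definition reduced_shocks_white_noise :: "param \<Rightarrow> bool" where
  "reduced_shocks_white_noise \<theta> \<longleftrightarrow>
     (\<forall>(M :: (int \<Rightarrow> real^5) measure) \<eta> s z. stationary_model \<theta> M \<eta> s z \<longrightarrow>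
        zero_mean_white_noise M (\<lambda>t w. R_mat *v \<eta> t w) (Sigma_mat \<theta>))"

text \<open>With \<open>var_nu2 \<theta> = 0\<close> the third row of \<open>Sigma_mat \<theta>\<close> vanishes, so that
  \<open>assumption1\<close> cannot hold under this restriction. \<open>assumption1_singular\<close> is
  its form for shock vectors that may have degenerate components.\<close>

definition assumption1 :: "param \<Rightarrow> bool" where
  "assumption1 \<theta> \<longleftrightarrow> reduced_shocks_white_noise \<theta> \<and> positive_definite (Sigma_mat \<theta>)"

definition assumption1_singular :: "param \<Rightarrow> bool" where
  "assumption1_singular \<theta> \<longleftrightarrow>
     reduced_shocks_white_noise \<theta> \<and> positive_semidefinite (Sigma_mat \<theta>)"

definition assumption2 :: "param \<Rightarrow> bool" where
  "assumption2 \<theta> \<longleftrightarrow> \<bar>rho \<theta>\<bar> < 1"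

definition assumption4NS :: "param \<Rightarrow> bool" where
  "assumption4NS \<theta> \<longleftrightarrow> invertible (D_mat ** Sigma_mat \<theta> ** transpose D_mat)"

definition assumption5NS :: "param \<Rightarrow> bool" where
  "assumption5NS \<theta> \<longleftrightarrow>
     full_row_rank (hcat (K_mat \<theta>) (A_mat \<theta> ** K_mat \<theta>)) \<and>
     full_column_rank (vcat (C_mat \<theta>) (C_mat \<theta> ** A_mat \<theta>))"


section \<open>Consistency of the two forms of the model\<close>

lemma exhaust_5:
  fixes x :: 5
  shows "x = 1 \<or> x = 2 \<or> x = 3 \<or> x = 4 \<or> x = 5"
proof (induct x)
  case (of_int z)
  then have "z = 0 \<or> z = 1 \<or> z = 2 \<or> z = 3 \<or> z = 4" by fastforce
  then show ?case by auto
qed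

lemma UNIV_5: "UNIV = {1::5, 2, 3, 4, 5}"
  using exhaust_5 by auto

lemma sum_5: "sum f (UNIV::5 set) = f 1 + f 2 + f 3 + f 4 + f 5"
  unfolding UNIV_5 by (simp add: ac_simps)

lemma forall_5: "(\<forall>i::5. P i) \<longleftrightarrow> P 1 \<and> P 2 \<and> P 3 \<and> P 4 \<and> P 5"
  by (metis exhaust_5)

lemma vector_5 [simp]:
  "(vector [a, b, c, d, e] :: ('a::zero)^5) $ 1 = a"
  "(vector [a, b, c, d, e] :: ('a::zero)^5) $ 2 = b"
  "(vector [a, b, c, d, e] :: ('a::zero)^5) $ 3 = c"
  "(vector [a, b, c, d, e] :: ('a::zero)^5) $ 4 = d"
  "(vector [a, b, c, d, e] :: ('a::zero)^5) $ 5 = e"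
  unfolding vector_def by simp_all

lemma Sigma_mat_eq: "Sigma_mat \<theta> = R_mat ** H_mat \<theta> ** transpose R_mat"
  by (simp add: vec_eq_iff forall_5 Sigma_mat_def R_mat_def H_mat_def matrix_matrix_mult_def
      transpose_def sum_5 algebra_simps)

lemma B_transition: "B_mat ** transition_mat \<theta> = A_mat \<theta> ** B_mat"
  by (simp add: vec_eq_iff forall_5 B_mat_def A_mat_def transition_mat_def
      matrix_matrix_mult_def mat_def sum_5 sum_1 vector_1)

lemma D_transition: "D_mat ** transition_mat \<theta> = C_mat \<theta> ** B_mat"
  by (simp add: vec_eq_iff forall_5 forall_2 B_mat_def C_mat_def D_mat_def transition_mat_def
      matrix_matrix_mult_def sum_5 sum_1 vector_1)

lemma assumption1_restricted: "var_nu2 \<theta> = 0 \<Longrightarrow> \<not> assumption1 \<theta>"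
proof
  assume "var_nu2 \<theta> = 0" and "assumption1 \<theta>"
  moreover have "axis 3 1 \<bullet> (Sigma_mat \<theta> *v axis (3::5) 1) = var_nu2 \<theta>"
    by (simp add: inner_axis' matrix_vector_mult_basis column_def Sigma_mat_def)
  moreover have "axis (3::5) (1::real) \<noteq> 0"
    by (simp add: axis_eq_0_iff)
  ultimately show False
    unfolding assumption1_def positive_definite_def by (metis less_irrefl)
qed

end

theory Submission
  imports Defs
begin

text \<open>Write \<open>\<omega>\<^sub>t = R_mat *v \<eta>\<^sub>t\<close>, x for the true value and V for its variance. Since x is the
  second vintage minus white noise, its second moments are bounded in t, and iterating
  \<open>x\<^sub>t = \<rho> x\<^sub>t\<^sub>-\<^sub>1 + \<omega>\<^sub>t\<^sub>,\<^sub>1\<close> backwards shows that x is uncorrelated with future shocks.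
  With \<open>\<sigma>\<^sub>\<nu>\<^sub>2\<^sup>2 = 0\<close> this gives \<open>\<Gamma>(1)\<^sub>2\<^sub>2 = \<rho>V\<close>, \<open>\<Gamma>(2)\<^sub>2\<^sub>2 = \<rho>\<^sup>2V\<close> and
  \<open>\<Gamma>(0)\<^sub>1\<^sub>2 = V - \<sigma>\<^sub>\<nu>\<^sub>1\<^sup>2\<close>, from which all parameters can be read off as soon as \<open>\<rho>V \<noteq> 0\<close>.
  Observability excludes \<open>\<rho> = 0\<close>. If V = 0, then the Riccati equation has the only
  nonnegative solution 0 and the Kalman gain vanishes, which contradicts controllability.\<close>

section \<open>Square integrable random variables\<close>

text \<open>Measurability is included because integrability of the square does not determine the
  sign of \<open>X\<close> measurably.\<close>

definition square_integrable :: "'w measure \<Rightarrow> ('w \<Rightarrow> real) \<Rightarrow> bool" where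
  "square_integrable M X \<longleftrightarrow> X \<in> borel_measurable M \<and> integrable M (\<lambda>w. (X w)\<^sup>2)"

definition inner_L2 :: "'w measure \<Rightarrow> ('w \<Rightarrow> real) \<Rightarrow> ('w \<Rightarrow> real) \<Rightarrow> real" where
  "inner_L2 M X Y = (LINT w|M. X w * Y w)"

lemma integrable_mult_square_integrable:
  assumes "square_integrable M X" "square_integrable M Y"
  shows "integrable M (\<lambda>w. X w * Y w)"
proof (rule Bochner_Integration.integrable_bound)
  show "integrable M (\<lambda>w. (X w)\<^sup>2 + (Y w)\<^sup>2)"
    using assms by (auto simp: square_integrable_def)
  show "(\<lambda>w. X w * Y w) \<in> borel_measurable M"
    using assms by (auto simp: square_integrable_def)
  have "\<bar>a * b\<bar> \<le> a\<^sup>2 + b\<^sup>2" for a b :: real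
  proof -
    have "0 \<le> (\<bar>a\<bar> - \<bar>b\<bar>)\<^sup>2" by simp
    then have "2 * \<bar>a * b\<bar> \<le> a\<^sup>2 + b\<^sup>2"
      by (simp add: power2_diff abs_mult)
    then show ?thesis by linarith
  qed
  then show "AE w in M. norm (X w * Y w) \<le> norm ((X w)\<^sup>2 + (Y w)\<^sup>2)"
    by simp
qed

lemma square_integrable_add:
  assumes "square_integrable M X" "square_integrable M Y"
  shows "square_integrable M (\<lambda>w. X w + Y w)"
proof -
  have "(\<lambda>w. (X w + Y w)\<^sup>2) = (\<lambda>w. (X w)\<^sup>2 + (Y w)\<^sup>2 + 2 * (X w * Y w))"
    by (auto simp: power2_sum)
  then show ?thesis
    using assms integrable_mult_square_integrable[OF assms]
    by (auto simp: square_integrable_def)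
qed

lemma square_integrable_cmult:
  assumes "square_integrable M X"
  shows "square_integrable M (\<lambda>w. c * X w)"
  using assms by (auto simp: square_integrable_def power_mult_distrib)

lemma square_integrable_diff:
  assumes "square_integrable M X" "square_integrable M Y"
  shows "square_integrable M (\<lambda>w. X w - Y w)"
  using square_integrable_add[OF assms(1) square_integrable_cmult[OF assms(2), of "-1"]] by simp

lemma inner_L2_commute: "inner_L2 M X Y = inner_L2 M Y X"
  by (simp add: inner_L2_def mult.commute)

lemma inner_L2_add_left:
  assumes "square_integrable M X" "square_integrable M Y" "square_integrable M Z"
  shows "inner_L2 M (\<lambda>w. X w + Y w) Z = inner_L2 M X Z + inner_L2 M Y Z"
  using assms by (simp add: inner_L2_def distrib_right integrable_mult_square_integrable)

lemma inner_L2_diff_left: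
  assumes "square_integrable M X" "square_integrable M Y" "square_integrable M Z"
  shows "inner_L2 M (\<lambda>w. X w - Y w) Z = inner_L2 M X Z - inner_L2 M Y Z"
  using assms by (simp add: inner_L2_def left_diff_distrib integrable_mult_square_integrable)

text \<open>No integrability is required: for a nonintegrable product the Bochner integral is 0 by
  convention, so scalars still factor out.\<close>

lemma inner_L2_cmult_left: "inner_L2 M (\<lambda>w. c * X w) Z = c * inner_L2 M X Z"
  by (simp add: inner_L2_def mult.assoc)

lemma inner_L2_add_right:
  assumes "square_integrable M X" "square_integrable M Y" "square_integrable M Z"
  shows "inner_L2 M Z (\<lambda>w. X w + Y w) = inner_L2 M Z X + inner_L2 M Z Y"
  using inner_L2_add_left[OF assms] by (simp add: inner_L2_commute)

lemma inner_L2_cmult_right: "inner_L2 M Z (\<lambda>w. c * X w) = c * inner_L2 M Z X"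
  using inner_L2_cmult_left by (metis inner_L2_commute)

lemma inner_L2_cong_AE:
  assumes "AE w in M. X w = X' w" "AE w in M. Y w = Y' w"
    and "square_integrable M X" "square_integrable M Y"
    and "square_integrable M X'" "square_integrable M Y'"
  shows "inner_L2 M X Y = inner_L2 M X' Y'"
  unfolding inner_L2_def
proof (rule integral_cong_AE)
  show "AE w in M. X w * Y w = X' w * Y' w"
    using assms(1,2) by eventually_elim simp
qed (use assms in \<open>auto simp: square_integrable_def\<close>)

text \<open>Weak form of Cauchy-Schwarz, obtained by expanding the squares of X + Y and X - Y. The
  crude constant suffices where only boundedness matters.\<close>

lemma abs_inner_L2_le:
  assumes "square_integrable M X" "square_integrable M Y"
  shows "\<bar>inner_L2 M X Y\<bar> \<le> inner_L2 M X X + inner_L2 M Y Y"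
proof -
  have sq: "0 \<le> inner_L2 M Z Z" for Z
    by (simp add: inner_L2_def)
  have "0 \<le> inner_L2 M (\<lambda>w. X w + Y w) (\<lambda>w. X w + Y w)"
       "0 \<le> inner_L2 M (\<lambda>w. X w + (-1) * Y w) (\<lambda>w. X w + (-1) * Y w)"
    by (rule sq)+
  then have "0 \<le> inner_L2 M X X + 2 * inner_L2 M X Y + inner_L2 M Y Y"
       "0 \<le> inner_L2 M X X - 2 * inner_L2 M X Y + inner_L2 M Y Y"
    using assms square_integrable_cmult[OF assms(2), of "-1"]
    by (simp_all only: inner_L2_add_left inner_L2_add_right square_integrable_add
        inner_L2_cmult_left inner_L2_cmult_right inner_L2_commute[of M Y X]) simp_all
  with sq[of X] sq[of Y] show ?thesis by linarith
qed

section \<open>Second moments of Gaussian variables\<close>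

lemma integrable_square_normal_law:
  assumes "0 \<le> v"
  shows "integrable (normal_law 0 v) (\<lambda>x. x\<^sup>2)"
proof (cases "v = 0")
  case True
  then show ?thesis
    by (auto simp: normal_law_def integrable_iff_bounded nn_integral_return)
next
  case False
  with assms have "0 < sqrt v" by simp
  from integrable_normal_moment[OF this, of 0 2] False show ?thesis
    by (simp add: normal_law_def integrable_density)
qed

lemma borel_measurable_vec_nth:
  fixes X :: "'w \<Rightarrow> real^'n"
  assumes "X \<in> borel_measurable M"
  shows "(\<lambda>w. X w $ i) \<in> borel_measurable M"
  using assms
  by (rule measurable_compose) (intro borel_measurable_continuous_onI continuous_intros)

lemma square_integrable_gaussian_process:
  assumes "zero_mean_gaussian_process M z"
  shows "square_integrable M (\<lambda>w. z t w $ i)"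
proof -
  have m [measurable]: "z t \<in> borel_measurable M"
    using assms by (simp add: zero_mean_gaussian_process_def)
  \<comment> \<open>A single coordinate is the linear functional of the process supported at time
    \<open>t\<close> with a unit vector as coefficient.\<close>
  obtain v where v: "0 \<le> v"
    "distr M borel (\<lambda>w. z t w $ i) = normal_law 0 v"
    using assms[unfolded zero_mean_gaussian_process_def, THEN conjunct2, rule_format,
        of "{t}" "\<lambda>_. axis i 1"]
    by (auto simp: inner_axis')
  have c: "(\<lambda>w. z t w $ i) \<in> borel_measurable M"
    using m by (rule borel_measurable_vec_nth)
  then have "integrable (distr M borel (\<lambda>w. z t w $ i)) (\<lambda>x. x\<^sup>2)"
    using integrable_square_normal_law[OF v(1)] v(2) by simp
  with c show ?thesis
    by (simp add: square_integrable_def integrable_distr_eq)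
qed

text \<open>After n backward steps the value at \<open>m\<close> is at most
  \<open>\<bar>a\<bar> ^ n * K\<close>, which tends to 0. The recursion is assumed only up to time
  \<open>m\<close> because in the application it breaks off at the time of a later shock.\<close>

lemma bounded_backward_recursion_eq_0:
  fixes q :: "int \<Rightarrow> real"
  assumes rec: "\<And>t. t \<le> m \<Longrightarrow> q t = a * q (t - 1)"
    and bound: "\<And>t. \<bar>q t\<bar> \<le> K" and "\<bar>a\<bar> < 1"
  shows "q m = 0"
proof -
  have "q m = a ^ n * q (m - int n)" for n
  proof (induction n)
    case (Suc n)
    with rec[of "m - int n"] show ?case by (simp add: algebra_simps)
  qed simp
  then have "\<bar>q m\<bar> \<le> \<bar>a\<bar> ^ n * K" for n
    by (metis abs_ge_zero abs_mult bound mult_left_mono power_abs zero_le_power)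
  moreover have "(\<lambda>n. \<bar>a\<bar> ^ n * K) \<longlonglongrightarrow> 0"
    using \<open>\<bar>a\<bar> < 1\<close> by (intro tendsto_mult_left_zero LIMSEQ_power_zero) simp
  ultimately have "\<bar>q m\<bar> \<le> 0"
    by (intro LIMSEQ_le_const) auto
  then show ?thesis by simp
qed

section \<open>The autocovariances\<close>

lemma transition_mat_mult_nth:
  "(transition_mat \<theta> *v v) $ i = (if i = 1 then rho \<theta> * v $ 1 else 0)"
  using exhaust_5[of i]
  by (auto simp: transition_mat_def matrix_vector_mult_def sum_5)

text \<open>\<open>V\<close> is the variance of the true value. Lagged moments are taken from the
  second vintage: with \<open>var_nu2 \<theta> = 0\<close> its errors are uncorrelated with the true
  value at all times, whereas the first news error is correlated with it.\<close>

lemma autocovariance_entries: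
  assumes "has_autocovariance \<theta> \<Gamma>" and white: "reduced_shocks_white_noise \<theta>"
    and rho: "\<bar>rho \<theta>\<bar> < 1" and nu2: "var_nu2 \<theta> = 0"
  obtains V where "V * (1 - (rho \<theta>)\<^sup>2) = var_y \<theta> + var_nu1 \<theta>"
    and "\<Gamma> 0 $ 1 $ 1 = V - var_nu1 \<theta> + var_zeta1 \<theta>"
    and "\<Gamma> 0 $ 1 $ 2 = V - var_nu1 \<theta>"
    and "\<Gamma> 0 $ 2 $ 2 = V + var_zeta2 \<theta>"
    and "\<Gamma> 1 $ 2 $ 2 = rho \<theta> * V"
    and "\<Gamma> 2 $ 2 $ 2 = (rho \<theta>)\<^sup>2 * V"
proof -
  from assms(1) obtain M \<eta> s z where mod: "stationary_model \<theta> (M :: (int \<Rightarrow> real^5) measure) \<eta> s z"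
    and \<Gamma>: "\<And>j t. \<Gamma> j = second_moment M z t (t - j)"
    unfolding has_autocovariance_def by blast
  define e where "e i t w = (R_mat *v \<eta> t w) $ i" for i t w
  define y where "y i t w = z t w $ i" for i t w
  \<comment> \<open>The true value is recovered from the observation and the shocks, since these are
    known to be square integrable, while the state is only known to be measurable. It agrees with
    the first state component almost everywhere.\<close>
  define x where "x t w = y 2 t w - e 3 t w - e 5 t w" for t w
  have wn: "zero_mean_white_noise M (\<lambda>t w. R_mat *v \<eta> t w) (Sigma_mat \<theta>)"
    using white mod unfolding reduced_shocks_white_noise_def by blast
  have e: "square_integrable M (e i t)" for i t
  proof -
    have "(\<lambda>w. R_mat *v \<eta> t w) \<in> borel_measurable M"
      using wn by (simp add: zero_mean_white_noise_def)
    then have "(\<lambda>w. (R_mat *v \<eta> t w) $ i) \<in> borel_measurable M"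
      by (rule borel_measurable_vec_nth)
    with wn show ?thesis
      by (simp add: square_integrable_def e_def[abs_def] zero_mean_white_noise_def)
  qed
  have ee: "inner_L2 M (e i t) (e k r) = (if t = r then Sigma_mat \<theta> $ i $ k else 0)" for i k t r
  proof -
    have "second_moment M (\<lambda>t w. R_mat *v \<eta> t w) t r $ i $ k = inner_L2 M (e i t) (e k r)"
      by (simp add: second_moment_def inner_L2_def e_def)
    with wn show ?thesis
      by (auto simp: zero_mean_white_noise_def)
  qed
  have y: "square_integrable M (y i t)" for i t
    using mod square_integrable_gaussian_process[of M z t i]
    by (simp add: stationary_model_def y_def[abs_def])
  have yy: "inner_L2 M (y i t) (y k (t - j)) = \<Gamma> j $ i $ k" for i k t j
    by (simp add: \<Gamma>[of j t] second_moment_def inner_L2_def y_def)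
  have x: "square_integrable M (x t)" for t
    unfolding x_def by (intro square_integrable_diff e y)
  have s_rec: "AE w in M. s t w = transition_mat \<theta> *v s (t - 1) w + R_mat *v \<eta> t w" for t
    using mod by (simp add: stationary_model_def)
  have s1: "AE w in M. s t w $ 1 = rho \<theta> * s (t - 1) w $ 1 + e 1 t w" for t
    using s_rec[of t] by eventually_elim
      (simp add: e_def transition_mat_mult_nth)
  have s2: "AE w in M. \<forall>i. i \<noteq> 1 \<longrightarrow> s t w $ i = e i t w" for t
    using s_rec[of t] by eventually_elim (simp add: e_def transition_mat_mult_nth)
  have z: "AE w in M. z t w = D_mat *v s t w" for t
    using mod by (simp add: stationary_model_def)
  have xs: "AE w in M. x t w = s t w $ 1" for t
    using z[of t] s2[of t] by eventually_elim
      (simp add: x_def y_def D_mat_def matrix_vector_mult_def sum_5)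
  have x_rec: "AE w in M. x t w = rho \<theta> * x (t - 1) w + e 1 t w" for t
    using s1[of t] xs[of t] xs[of "t - 1"] by eventually_elim simp
  have y1: "AE w in M. y 1 t w = x t w + e 2 t w + e 4 t w" for t
    using xs[of t] z[of t] s2[of t] by eventually_elim
      (simp add: y_def D_mat_def matrix_vector_mult_def sum_5)
  have y2: "y 2 t = (\<lambda>w. x t w + e 3 t w + e 5 t w)" for t
    by (simp add: x_def fun_eq_iff)
  note sq = e x square_integrable_add square_integrable_cmult
  note bilin = inner_L2_add_left inner_L2_add_right inner_L2_cmult_left inner_L2_cmult_right
  \<comment> \<open>Pairing the state equation with a variable \<open>Z\<close> turns it into a
    scalar recursion; the moments below come from suitable choices of \<open>Z\<close>.\<close>
  have x_rec_inner: "inner_L2 M (x t) Z = rho \<theta> * inner_L2 M (x (t - 1)) Z + inner_L2 M (e 1 t) Z"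
    if "square_integrable M Z" for t Z
    using inner_L2_cong_AE[OF x_rec[of t], of Z Z] that by (simp add: bilin sq)
  \<comment> \<open>The cross term of observation and noise is not yet known, so twice its crude
    bound is added to the two squares, whence the factor 3. The bound is uniform in
    \<open>t\<close>.\<close>
  have x_bound: "inner_L2 M (x t) (x t) \<le> 3 * \<Gamma> 0 $ 2 $ 2 + 3 * var_zeta2 \<theta>" for t
  proof -
    let ?n = "\<lambda>w. e 3 t w + e 5 t w"
    have n: "square_integrable M ?n" by (intro sq)
    have nn: "inner_L2 M ?n ?n = var_zeta2 \<theta>"
      by (simp add: bilin sq ee Sigma_mat_def nu2)
    have xn: "x t = (\<lambda>w. y 2 t w - ?n w)"
      by (simp add: x_def fun_eq_iff)
    have "inner_L2 M (x t) (x t)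
        = inner_L2 M (y 2 t) (y 2 t) - 2 * inner_L2 M (y 2 t) ?n + inner_L2 M ?n ?n"
      using x[of t] y[of 2 t] n unfolding xn
      by (subst inner_L2_diff_left; simp add: inner_L2_commute[of _ _ "\<lambda>w. y 2 t w - (e 3 t w + e 5 t w)"]
          inner_L2_diff_left inner_L2_commute[of _ ?n "y 2 t"])
    with abs_inner_L2_le[OF y[of 2 t] n] yy[of 2 t 2 0] nn show ?thesis
      by simp
  qed
  \<comment> \<open>Causality is not part of the model: boundedness of the state and
    \<open>\<bar>rho \<theta>\<bar> < 1\<close> enforce it. Up to time \<open>t\<close> the driving
    shock is uncorrelated with the one at \<open>r\<close>, so the recursion is homogeneous.\<close>
  have future: "inner_L2 M (x t) (e i r) = 0" if "t < r" for t r i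
  proof (rule bounded_backward_recursion_eq_0[where a = "rho \<theta>" and q = "\<lambda>t. inner_L2 M (x t) (e i r)"])
    show "inner_L2 M (x u) (e i r) = rho \<theta> * inner_L2 M (x (u - 1)) (e i r)" if "u \<le> t" for u
      using x_rec_inner[OF e, of u i r] that \<open>t < r\<close> by (simp add: ee)
    show "\<bar>inner_L2 M (x u) (e i r)\<bar>
        \<le> 3 * \<Gamma> 0 $ 2 $ 2 + 3 * var_zeta2 \<theta> + inner_L2 M (e i r) (e i r)" for u
      using abs_inner_L2_le[OF x[of u] e[of i r]] x_bound[of u] by linarith
  qed (rule rho)
  have present: "inner_L2 M (x t) (e i t) = Sigma_mat \<theta> $ 1 $ i" for t i
    using x_rec_inner[OF e, of t i t] by (simp add: ee future)
  have past: "inner_L2 M (x t) (e i (t - 1)) = rho \<theta> * Sigma_mat \<theta> $ 1 $ i" for t i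
    using x_rec_inner[OF e, of t i "t - 1"] by (simp add: ee present)
  have past2: "inner_L2 M (x t) (e i (t - 2)) = (rho \<theta>)\<^sup>2 * Sigma_mat \<theta> $ 1 $ i" for t i
    using x_rec_inner[OF e, of t i "t - 2"] past[of "t - 1" i]
    by (simp add: ee power2_eq_square)
  \<comment> \<open>Defining \<open>V\<close> through \<Gamma> makes it independent of time at once;
    \<open>xx\<close> then identifies it as the variance of the true value.\<close>
  define V where "V = \<Gamma> 0 $ 2 $ 2 - var_zeta2 \<theta>"
  have xx: "inner_L2 M (x t) (x t) = V" for t
    using yy[of 2 t 2 0]
    by (simp add: V_def y2 bilin sq ee present inner_L2_commute[of M "e i t" "x t" for i]
        Sigma_mat_def nu2)
  have ex: "inner_L2 M (e i t) (x r) = 0" if "r < t" for i t r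
    using future[OF that] by (simp add: inner_L2_commute)
  have xx1: "inner_L2 M (x t) (x (t - 1)) = rho \<theta> * V" for t
    using x_rec_inner[OF x, of t "t - 1"] by (simp add: xx ex)
  have xx2: "inner_L2 M (x t) (x (t - 2)) = (rho \<theta>)\<^sup>2 * V" for t
    using x_rec_inner[OF x, of t "t - 2"] xx1[of "t - 1"] by (simp add: ex power2_eq_square)
  have ex0: "inner_L2 M (e i t) (x t) = Sigma_mat \<theta> $ 1 $ i" for i t
    using present by (simp add: inner_L2_commute)
  show thesis
  proof
    \<comment> \<open>Stationary variance equation: the recursion is paired with the current true
      value, to which the current shock contributes its own variance.\<close>
    have "V = rho \<theta> * (rho \<theta> * V) + Sigma_mat \<theta> $ 1 $ 1"
      using x_rec_inner[OF x, of 0 0] xx1[of 0]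
      by (simp add: xx ex0 inner_L2_commute[of M "x (-1)"])
    then show "V * (1 - (rho \<theta>)\<^sup>2) = var_y \<theta> + var_nu1 \<theta>"
      by (simp add: Sigma_mat_def nu2 power2_eq_square algebra_simps)
    \<comment> \<open>The decomposition of the first vintage holds only almost everywhere and must
      pass through the integral; that of the second is exact by the choice of
      \<open>x\<close>.\<close>
    have "\<Gamma> 0 $ 1 $ 1 = inner_L2 M (\<lambda>w. x 0 w + e 2 0 w + e 4 0 w) (\<lambda>w. x 0 w + e 2 0 w + e 4 0 w)"
      using inner_L2_cong_AE[OF y1[of 0] y1[of 0]] yy[of 1 0 1 0] by (simp add: y sq)
    then show "\<Gamma> 0 $ 1 $ 1 = V - var_nu1 \<theta> + var_zeta1 \<theta>"
      by (simp add: bilin sq ee xx ex0 present Sigma_mat_def nu2)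
    have "\<Gamma> 0 $ 1 $ 2 = inner_L2 M (\<lambda>w. x 0 w + e 2 0 w + e 4 0 w) (y 2 0)"
      using inner_L2_cong_AE[OF y1[of 0], of "y 2 0" "y 2 0"] yy[of 1 0 2 0] by (simp add: y sq)
    then show "\<Gamma> 0 $ 1 $ 2 = V - var_nu1 \<theta>"
      by (simp add: y2 bilin sq ee xx ex0 present Sigma_mat_def nu2)
    show "\<Gamma> 0 $ 2 $ 2 = V + var_zeta2 \<theta>"
      by (simp add: V_def)
    show "\<Gamma> 1 $ 2 $ 2 = rho \<theta> * V"
      unfolding yy[of 2 0 2 1, symmetric] y2
      using past[of 0] xx1[of 0] by (simp add: bilin sq ee ex Sigma_mat_def nu2)
    show "\<Gamma> 2 $ 2 $ 2 = (rho \<theta>)\<^sup>2 * V"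
      unfolding yy[of 2 0 2 2, symmetric] y2
      using past2[of 0] xx2[of 0] by (simp add: bilin sq ee ex Sigma_mat_def nu2)
  qed
qed

section \<open>Minimality\<close>

text \<open>For \<open>rho \<theta> = 0\<close> the observability matrix is zero and has rank 0
  instead of 1.\<close>

lemma observable_imp_rho_nonzero:
  assumes "assumption5NS \<theta>"
  shows "rho \<theta> \<noteq> 0"
proof
  assume "rho \<theta> = 0"
  then have "vcat (C_mat \<theta>) (C_mat \<theta> ** A_mat \<theta>) = 0"
    by (auto simp: vec_eq_iff vcat_def C_mat_def forall_2 vector_1 matrix_matrix_mult_def
        split: sum.split)
  with assms show False
    by (simp add: assumption5NS_def full_column_rank_def)
qed

section \<open>The Riccati equation without state shocks\<close>

lemma matrix_inv_unique:
  fixes A :: "real^'n^'m"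
  assumes "A ** B = mat 1" "B ** A = mat 1"
  shows "matrix_inv A = B"
  unfolding matrix_inv_def
proof (rule some_equality)
  show "C = B" if "A ** C = mat 1 \<and> C ** A = mat 1" for C
    using assms that by (metis matrix_mul_assoc matrix_mul_lid matrix_mul_rid)
qed (use assms in simp)

text \<open>Without state shocks the Riccati equation equates
  \<open>p * (1 - (rho \<theta>)\<^sup>2)\<close> with a nonpositive term, which forces
  \<open>p = 0\<close>. Existence and uniqueness are both shown because the steady state variance is
  a definite description.\<close>

lemma K_mat_eq_0:
  assumes nn: "variances_nonneg \<theta>" and rho: "\<bar>rho \<theta>\<bar> < 1" and inv: "assumption4NS \<theta>"
    and z: "var_y \<theta> = 0" "var_nu1 \<theta> = 0" "var_nu2 \<theta> = 0"
  shows "K_mat \<theta> = 0"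
proof -
  let ?d = "var_zeta1 \<theta>" and ?e = "var_zeta2 \<theta>"
  note mats = vec_eq_iff forall_2 forall_5 matrix_matrix_mult_def transpose_def sum_5 sum_2 sum_1
    vector_1 B_mat_def C_mat_def D_mat_def Sigma_mat_def mat_def
  have DD: "Sigma_DD \<theta> = vector [vector [?d, 0], vector [0, ?e]]"
    by (simp add: Sigma_DD_def mats z)
  have BD: "Sigma_BD \<theta> = 0" and DB: "Sigma_DB \<theta> = 0" and BB: "Sigma_BB \<theta> = 0"
    by (simp_all add: Sigma_BD_def Sigma_DB_def Sigma_BB_def mats z)
  \<comment> \<open>The matrix is diagonal here, so nonsingularity makes both noise variances
    positive.\<close>
  have "det (Sigma_DD \<theta>) \<noteq> 0"
    using inv by (simp add: assumption4NS_def Sigma_DD_def invertible_det_nz)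
  then have pos: "0 < ?d" "0 < ?e"
    using nn by (auto simp: DD det_2 variances_nonneg_def)
  have gain0: "gain \<theta> 0 = 0"
    by (simp add: gain_def BD)
  have "p = 0" if "0 \<le> p" and ric: "riccati \<theta> p" for p
  proof -
    define c where "c = p * (rho \<theta>)\<^sup>2"
    \<comment> \<open>This is the determinant of \<open>?M\<close>, and \<open>?N\<close> below is
      the adjugate of \<open>?M\<close> divided by it.\<close>
    define \<Delta> where "\<Delta> = ?d * ?e + c * (?d + ?e)"
    have c: "0 \<le> c" using \<open>0 \<le> p\<close> by (simp add: c_def)
    then have \<Delta>: "0 < \<Delta>" using pos by (simp add: \<Delta>_def add_pos_nonneg)
    let ?M = "p *\<^sub>R (C_mat \<theta> ** transpose (C_mat \<theta>)) + Sigma_DD \<theta>"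
    let ?N = "vector [vector [(c + ?e) / \<Delta>, - c / \<Delta>], vector [- c / \<Delta>, (c + ?d) / \<Delta>]] :: real^2^2"
    have M: "?M = vector [vector [c + ?d, c], vector [c, c + ?e]]"
      by (simp add: DD mats c_def power2_eq_square)
    have "?M ** ?N = mat 1" "?N ** ?M = mat 1"
      using \<Delta> unfolding M
      by (simp_all add: vec_eq_iff forall_2 matrix_matrix_mult_def sum_2 mat_def field_simps)
         (simp_all add: \<Delta>_def algebra_simps)
    then have "matrix_inv ?M = ?N"
      by (rule matrix_inv_unique)
    then have "gain \<theta> p = ((p * rho \<theta>) *\<^sub>R transpose (C_mat \<theta>)) ** ?N"
      by (simp only: gain_def BD add_0_right)
    then have "gain \<theta> p $ 1 $ 1 = c * ?e / \<Delta>" "gain \<theta> p $ 1 $ 2 = c * ?d / \<Delta>"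
      using \<Delta> by (simp_all add: mats c_def field_simps power2_eq_square)
    moreover have "p = p * (rho \<theta>)\<^sup>2 - (gain \<theta> p $ 1 $ 1 + gain \<theta> p $ 1 $ 2) * c"
      using ric unfolding riccati_def
      by (simp add: BB DB mats c_def algebra_simps power2_eq_square)
    ultimately have "p = p * (rho \<theta>)\<^sup>2 - c * c * (?d + ?e) / \<Delta>"
      by (simp add: add_divide_distrib algebra_simps)
    moreover have "0 \<le> c * c * (?d + ?e) / \<Delta>"
      using c \<Delta> pos by simp
    ultimately have "p * (1 - (rho \<theta>)\<^sup>2) \<le> 0"
      by (simp add: algebra_simps)
    moreover have "0 < 1 - (rho \<theta>)\<^sup>2"
      using rho by (simp add: abs_square_less_1)
    ultimately show "p = 0"
      using \<open>0 \<le> p\<close> by (simp add: mult_le_0_iff)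
  qed
  moreover have "riccati \<theta> 0"
    by (simp add: riccati_def gain0 BB)
  ultimately have "steady_state_variance \<theta> = 0"
    unfolding steady_state_variance_def by (intro the_equality) auto
  then show ?thesis
    by (simp add: K_mat_def gain0)
qed

text \<open>If the sum were 0, both nonnegative variances would vanish, and with them the Kalman
  gain and the controllability matrix.\<close>

lemma controllable_imp_state_shock_nonzero:
  assumes "variances_nonneg \<theta>" "assumption2 \<theta>" "assumption4NS \<theta>" "assumption5NS \<theta>"
    and "var_nu2 \<theta> = 0"
  shows "var_y \<theta> + var_nu1 \<theta> \<noteq> 0"
proof
  assume "var_y \<theta> + var_nu1 \<theta> = 0"
  then have "var_y \<theta> = 0" "var_nu1 \<theta> = 0"
    using assms(1) by (simp_all add: variances_nonneg_def)
  then have "K_mat \<theta> = 0"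
    using K_mat_eq_0 assms by (simp add: assumption2_def)
  then have "hcat (K_mat \<theta>) (A_mat \<theta> ** K_mat \<theta>) = 0"
    by (simp add: vec_eq_iff hcat_def matrix_matrix_mult_def split: sum.split)
  with assms(4) show False
    by (simp add: assumption5NS_def full_row_rank_def)
qed

section \<open>Identification\<close>

text \<open>Only the white noise statement is assumed, which is common to both forms of the first
  assumption.\<close>

lemma identified_if_white_noise:
  assumes nonneg: "\<And>\<theta>. \<theta> \<in> P \<Longrightarrow> variances_nonneg \<theta>"
    and stable: "\<And>\<theta>. \<theta> \<in> P \<Longrightarrow> assumption2 \<theta>"
    and nonsing: "\<And>\<theta>. \<theta> \<in> P \<Longrightarrow> assumption4NS \<theta>"
    and minimal: "\<And>\<theta>. \<theta> \<in> P \<Longrightarrow> assumption5NS \<theta>"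
    and white: "\<And>\<theta>. \<theta> \<in> P \<Longrightarrow> reduced_shocks_white_noise \<theta>"
    and nu2: "\<And>\<theta>. \<theta> \<in> P \<Longrightarrow> var_nu2 \<theta> = 0"
  shows "identified_on P"
  unfolding identified_on_def
proof (intro ballI impI)
  fix \<theta> \<theta>' assume P: "\<theta> \<in> P" "\<theta>' \<in> P" and "observationally_equivalent \<theta> \<theta>'"
  then obtain \<Gamma> where \<Gamma>: "has_autocovariance \<theta> \<Gamma>" "has_autocovariance \<theta>' \<Gamma>"
    unfolding observationally_equivalent_def by blast
  have stable': "\<bar>rho \<theta>\<bar> < 1" "\<bar>rho \<theta>'\<bar> < 1"
    using stable P by (auto simp: assumption2_def)
  obtain V where V: "V * (1 - (rho \<theta>)\<^sup>2) = var_y \<theta> + var_nu1 \<theta>"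
    "\<Gamma> 0 $ 1 $ 1 = V - var_nu1 \<theta> + var_zeta1 \<theta>" "\<Gamma> 0 $ 1 $ 2 = V - var_nu1 \<theta>"
    "\<Gamma> 0 $ 2 $ 2 = V + var_zeta2 \<theta>"
    "\<Gamma> 1 $ 2 $ 2 = rho \<theta> * V" "\<Gamma> 2 $ 2 $ 2 = (rho \<theta>)\<^sup>2 * V"
    using autocovariance_entries[OF \<Gamma>(1) white stable'(1) nu2] P by blast
  obtain V' where V': "V' * (1 - (rho \<theta>')\<^sup>2) = var_y \<theta>' + var_nu1 \<theta>'"
    "\<Gamma> 0 $ 1 $ 1 = V' - var_nu1 \<theta>' + var_zeta1 \<theta>'" "\<Gamma> 0 $ 1 $ 2 = V' - var_nu1 \<theta>'"
    "\<Gamma> 0 $ 2 $ 2 = V' + var_zeta2 \<theta>'"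
    "\<Gamma> 1 $ 2 $ 2 = rho \<theta>' * V'" "\<Gamma> 2 $ 2 $ 2 = (rho \<theta>')\<^sup>2 * V'"
    using autocovariance_entries[OF \<Gamma>(2) white stable'(2) nu2] P by blast
  have "V \<noteq> 0"
    using controllable_imp_state_shock_nonzero[of \<theta>] V(1) P nonneg stable nonsing minimal nu2
    by force
  moreover have r: "rho \<theta> \<noteq> 0"
    using observable_imp_rho_nonzero minimal P by blast
  ultimately have nz: "rho \<theta> * V \<noteq> 0" by simp
  \<comment> \<open>The lag 2 entry is the autoregressive coefficient times the lag 1 entry under
    either parameter; the common lag 1 entry is nonzero and cancels.\<close>
  have "rho \<theta> * (rho \<theta> * V) = rho \<theta>' * (rho \<theta> * V)"
    using V(5,6) V'(5,6) by (metis mult.assoc power2_eq_square)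
  with nz have rho: "rho \<theta> = rho \<theta>'" by simp
  with V(5) V'(5) r have "V = V'" by simp
  \<comment> \<open>Given the coefficient and \<open>V\<close>, the lag 0 entries yield
    \<open>var_nu1\<close>, \<open>var_zeta1\<close> and \<open>var_zeta2\<close>, and the variance
    equation then yields \<open>var_y\<close>.\<close>
  with rho V V' nu2[OF P(1)] nu2[OF P(2)] show "\<theta> = \<theta>'"
    by (intro param.equality) auto
qed

theorem theorem1:
  fixes \<Theta> :: "param set"
  assumes "\<forall>\<theta>\<in>\<Theta>. variances_nonneg \<theta>"
    and "\<forall>\<theta>\<in>\<Theta>. assumption2 \<theta>"
    and "\<forall>\<theta>\<in>\<Theta>. assumption4NS \<theta>"
    and "\<forall>\<theta>\<in>\<Theta>. assumption5NS \<theta>"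
  shows "((\<forall>\<theta>\<in>\<Theta>. assumption1 \<theta>) \<longrightarrow> identified_on {\<theta>\<in>\<Theta>. var_nu2 \<theta> = 0}) \<and>
         ((\<forall>\<theta>\<in>\<Theta>. assumption1_singular \<theta>) \<longrightarrow> identified_on {\<theta>\<in>\<Theta>. var_nu2 \<theta> = 0})"
proof (intro conjI impI)
  show "identified_on {\<theta>\<in>\<Theta>. var_nu2 \<theta> = 0}" if "\<forall>\<theta>\<in>\<Theta>. assumption1 \<theta>"
    using assms that by (intro identified_if_white_noise) (auto simp: assumption1_def)
  show "identified_on {\<theta>\<in>\<Theta>. var_nu2 \<theta> = 0}" if "\<forall>\<theta>\<in>\<Theta>. assumption1_singular \<theta>"
    using assms that by (intro identified_if_white_noise) (auto simp: assumption1_singular_def)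
qed

end
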